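(* Consider the problem $\min_{x\in\mathcal X} f(x)$, $f=\frac1n\sum_{i=1}^n f_i$, where $\mathcal X\subset\mathbb R^d$ is convex and compact with diameter $D$, i.e. $\|x-y\|\le D$ for all $x,y\in\mathcal X$; $f$ is $L$-smooth on $\mathcal X$; and each $f_i$ is $L_i$-smooth on $\mathcal X$ (neither $f$ nor the $f_i$ are assumed convex). Let $\tilde L^2=\frac1n\sum_{i=1}^n L_i^2$, let $x^*$ be a global (possibly non-unique) minimizer of $f$ on $\mathcal X$, and let $h^0:=f(x^0)-f(x^* )$. Then the Sarah Frank-Wolfe algorithm (described in the context) with batch size $b$, probability $p=\frac{2b}{n+2b}$ and, for a total number $K$ of iterations, step sizes $\eta_k=\frac1{\sqrt K}$, achieves an $\varepsilon$ suboptimality in expectation, i.e. $\mathbb E\left[\min_{0\le k\le K-1}\operatorname{gap}(x^k)\right]\le\varepsilon$ with $\operatorname{gap}(y)=\max_{x\in\mathcal X}\langle\nabla f(y),y-x\rangle$, with $$\mathcal O\left(\left[\frac{h^0}{\varepsilon}\right]^2+\left[\frac{LD^2}{\varepsilon}\right]^2\left[1+\frac{\tilde L^2 n}{L^2b^2}\right]\right)\ \text{ LMO calls,}$$ and $$\mathcal O\left(b\left[\frac{h^0}{\varepsilon}\right]^2+\left[\frac{LD^2}{\varepsilon}\right]^2\left[b+\frac{\tilde L^2 n}{L^2b}\right]\right)\ \text{ stochastic oracle calls.}$$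
   Context: Norms and inner products are Euclidean and $[n]=\{1,\dots,n\}$. The functions $f,f_i:\mathcal X\to\mathbb R$ are differentiable. A function $h$ is $M$-smooth on $\mathcal X$, with constant $M>0$, if $\|\nabla h(x)-\nabla h(y)\|\le M\|x-y\|$ for all $x,y\in\mathcal X$. Sarah Frank-Wolfe algorithm. Parameters: step sizes $\{\eta_k\}_{k\ge0}$, probability $p$, batch size $b$. Initialization: choose $x^0\in\mathcal X$; $g^0=\nabla f(x^0)$. For $k=0,1,\dots,K-1$: (1) compute $s^k=\arg\min_{s\in\mathcal X}\langle g^k,s\rangle$; (2) $x^{k+1}=x^k+\eta_k(s^k-x^k)$; (3) generate a batch $S_k$ of $b$ indices, drawn uniformly and independently at random from $[n]$; (4) with probability $p$ set $g^{k+1}=\nabla f(x^{k+1})$; with probability $1-p$ set $g^{k+1}=g^k+\frac1b\sum_{i\in S_k}[\nabla f_i(x^{k+1})-\nabla f_i(x^k)]$. Complexity measures. An LMO (linear minimization oracle) call is one execution of step (1), so the number of LMO calls equals the number of iterations. A stochastic oracle call is the computation of a gradient $\nabla f_i$ for some $i\in[n]$; each iteration uses on average $pn+(1-p)\cdot 2b$ such calls. $\mathcal O(\cdot)$ hides an absolute numerical constant.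
   Formalization: Each complexity bound is read as the maximum of the O(·) expression and the cost of a single iteration, since at least one iteration is needed even when the expression is near 0 (e.g. a one-point set); the n gradients for the initial g^0 are not counted. *)

theory Defs
  imports "HOL-Probability.Probability"
begin

text \<open>
  Functions are only required to be differentiable on the set \<open>X\<close>, which may have empty
  interior. \<open>G\<close> is then a gradient of \<open>h\<close> on \<open>X\<close> if it represents the derivative of \<open>h\<close> within
  \<open>X\<close>. It is the usual gradient at interior points of \<open>X\<close>. If \<open>h\<close> is differentiable at all
  points of \<open>X\<close> as a function on the whole space, its ordinary gradient is a gradient on \<open>X\<close>
  in this sense.
\<close>

definition gradient_on :: "'a::euclidean_space set \<Rightarrow> ('a \<Rightarrow> real) \<Rightarrow> ('a \<Rightarrow> 'a) \<Rightarrow> bool" where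
  "gradient_on X h G \<longleftrightarrow> (\<forall>x\<in>X. (h has_derivative (\<lambda>v. G x \<bullet> v)) (at x within X))"

text \<open>\<open>smooth_on M X h G\<close>: \<open>h\<close> is \<open>M\<close>-smooth on \<open>X\<close>, with gradient \<open>G\<close>.\<close>

definition smooth_on :: "real \<Rightarrow> 'a::euclidean_space set \<Rightarrow> ('a \<Rightarrow> real) \<Rightarrow> ('a \<Rightarrow> 'a) \<Rightarrow> bool" where
  "smooth_on M X h G \<longleftrightarrow> 0 < M \<and> gradient_on X h G \<and>
     (\<forall>x\<in>X. \<forall>y\<in>X. norm (G x - G y) \<le> M * norm (x - y))"

definition avg_fun :: "nat \<Rightarrow> (nat \<Rightarrow> 'a \<Rightarrow> real) \<Rightarrow> 'a \<Rightarrow> real" where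
  "avg_fun n f x = (1 / real n) * (\<Sum>i=1..n. f i x)"

text \<open>For compact \<open>X\<close> and \<open>y \<in> X\<close> the supremum is a maximum.\<close>

definition fw_gap :: "'a::euclidean_space set \<Rightarrow> ('a \<Rightarrow> 'a) \<Rightarrow> 'a \<Rightarrow> real" where
  "fw_gap X G y = (SUP x\<in>X. G y \<bullet> (y - x))"

text \<open>
  A linear minimization oracle: \<open>lmo k g\<close> is the minimizer returned in iteration \<open>k\<close> for the
  direction \<open>g\<close>. Ties may be broken in an arbitrary way, which may differ between iterations.
\<close>

definition is_lmo :: "'a::euclidean_space set \<Rightarrow> (nat \<Rightarrow> 'a \<Rightarrow> 'a) \<Rightarrow> bool" where
  "is_lmo X lmo \<longleftrightarrow> (\<forall>k g. is_arg_min (\<lambda>s. g \<bullet> s) (\<lambda>s. s \<in> X) (lmo k g))"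

text \<open>
  The randomness of iteration \<open>k\<close> is a pair \<open>\<omega> k = (c, S)\<close>: the flag \<open>c\<close> says whether the full
  gradient is computed, and \<open>S 0, \<dots>, S (b - 1)\<close> are the indices of the batch, which are drawn
  independently and hence may repeat.
\<close>

type_synonym draws = "nat \<Rightarrow> bool \<times> (nat \<Rightarrow> nat)"

definition draws_pmf :: "nat \<Rightarrow> real \<Rightarrow> nat \<Rightarrow> nat \<Rightarrow> draws pmf" where
  "draws_pmf n p b K =
     Pi_pmf {..<K} undefined
       (\<lambda>_. pair_pmf (bernoulli_pmf p) (Pi_pmf {..<b} 0 (\<lambda>_. pmf_of_set {1..n})))"

text \<open>
  The pair \<open>(x\<^sup>k, g\<^sup>k)\<close> of the Sarah Frank-Wolfe algorithm, where \<open>gF\<close> and \<open>gf i\<close> are the gradients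
  of \<open>f\<close> and \<open>f\<^sub>i\<close>.
\<close>

primrec sarah_fw ::
  "('a::euclidean_space \<Rightarrow> 'a) \<Rightarrow> (nat \<Rightarrow> 'a \<Rightarrow> 'a) \<Rightarrow> (nat \<Rightarrow> 'a \<Rightarrow> 'a) \<Rightarrow> (nat \<Rightarrow> real) \<Rightarrow> nat \<Rightarrow> 'a
     \<Rightarrow> draws \<Rightarrow> nat \<Rightarrow> 'a \<times> 'a" where
  "sarah_fw gF gf lmo \<eta> b x0 \<omega> 0 = (x0, gF x0)"
| "sarah_fw gF gf lmo \<eta> b x0 \<omega> (Suc k) =
     (let (x, g) = sarah_fw gF gf lmo \<eta> b x0 \<omega> k;
          (c, S) = \<omega> k;
          s = lmo k g;
          x' = x + \<eta> k *\<^sub>R (s - x);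
          g' = (if c then gF x'
                else g + (1 / real b) *\<^sub>R (\<Sum>j<b. gf (S j) x' - gf (S j) x))
      in (x', g'))"

definition min_gap ::
  "'a::euclidean_space set \<Rightarrow> ('a \<Rightarrow> 'a) \<Rightarrow> (nat \<Rightarrow> 'a \<Rightarrow> 'a) \<Rightarrow> (nat \<Rightarrow> 'a \<Rightarrow> 'a) \<Rightarrow> (nat \<Rightarrow> real)
     \<Rightarrow> nat \<Rightarrow> 'a \<Rightarrow> nat \<Rightarrow> draws \<Rightarrow> real" where
  "min_gap X gF gf lmo \<eta> b x0 K \<omega> =
     Min ((\<lambda>k. fw_gap X gF (fst (sarah_fw gF gf lmo \<eta> b x0 \<omega> k))) ` {..<K})"

text \<open>
  The number of gradients of the \<open>f\<^sub>i\<close> computed in \<open>K\<close> iterations: \<open>n\<close> for a full gradient and two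
  for each index of a batch. The computation of \<open>g\<^sup>0\<close>, which precedes the iterations, is not
  counted.
\<close>

definition stoch_calls :: "nat \<Rightarrow> nat \<Rightarrow> nat \<Rightarrow> draws \<Rightarrow> nat" where
  "stoch_calls n b K \<omega> = (\<Sum>k<K. if fst (\<omega> k) then n else 2 * b)"

text \<open>
  The absolute constant hidden in the \<open>\<O>\<close>-notation. It is a fixed number, since an existentially
  quantified constant in a theorem about a type \<open>'a::euclidean_space\<close> could depend on \<open>'a\<close> and
  hence on the dimension.
\<close>

definition complexity_const :: real where
  "complexity_const = 24"

end

theory Submission
  imports Defs
begin

text \<open>
  The argument is the usual Frank-Wolfe descent with an inexact gradient. One step of size \<open>\<eta>\<close>
  satisfies, by smoothness and by optimality of the oracle's answer,
  \<open>\<eta> gap(x\<^sup>k) \<le> f(x\<^sup>k) - f(x\<^sup>k\<^sup>+\<^sup>1) + \<eta> D \<parallel>e\<^sup>k\<parallel> + L \<eta>\<^sup>2 D\<^sup>2 / 2\<close>, where \<open>e\<^sup>k\<close> is the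
  error of the gradient estimator (\<open>gap_step\<close>). Summation over \<open>K\<close> steps telescopes the objective
  values, so it remains to bound the expected error.

  Given the past, \<open>e\<^sup>k\<^sup>+\<^sup>1\<close> is \<open>0\<close> with probability \<open>p\<close>, and otherwise \<open>e\<^sup>k\<close> plus the mean of \<open>b\<close>
  independent centred vectors, whose second moments are at most \<open>Lt\<^sup>2 \<eta>\<^sup>2 D\<^sup>2\<close>. Hence
  \<open>E \<parallel>e\<^sup>k\<^sup>+\<^sup>1\<parallel>\<^sup>2 \<le> (1 - p) (E \<parallel>e\<^sup>k\<parallel>\<^sup>2 + Lt\<^sup>2 \<eta>\<^sup>2 D\<^sup>2 / b)\<close> (\<open>second_moment_step\<close>), and all
  second moments stay below the fixed point of this recursion. For the chosen \<open>p\<close> one has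
  \<open>(1 - p) / p = n / (2 b)\<close>, so with \<open>\<eta> = 1 / sqrt K\<close>, \<open>A = h0 / \<epsilon>\<close>, \<open>B = L D\<^sup>2 / \<epsilon>\<close> and
  \<open>c = Lt\<^sup>2 n / (L\<^sup>2 b\<^sup>2)\<close> the expected minimal gap is at most
  \<open>\<epsilon> (A + B / 2 + B sqrt (c / 2)) / sqrt K\<close>. By the Cauchy-Schwarz inequality this is at most
  \<open>\<epsilon>\<close> as soon as \<open>K \<ge> 3 T\<close> with \<open>T = A\<^sup>2 + B\<^sup>2 (1 + c)\<close>. Each iteration costs at most
  \<open>4 b\<close> gradient evaluations on average, and there is a \<open>K \<ge> 3 T\<close> that is \<open>1\<close> or at most \<open>6 T\<close>.

  The set \<open>X\<close> may have empty interior, and then the gradient \<open>gF\<close> of the average need not be the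
  average of the gradients \<open>gf i\<close>: they agree only when tested against differences of points of \<open>X\<close>
  (\<open>gradient_on_unique\<close>). The error is therefore defined as the accumulated sampling noise, and
  \<open>est_error_inner\<close> shows that it acts on such differences like \<open>g\<^sup>k - gF x\<^sup>k\<close>.
\<close>

section \<open>Smooth functions on a convex set\<close>

lemma has_derivative_along_segment:
  assumes "gradient_on X h G" "convex X" "x \<in> X" "y \<in> X" "t \<in> {0..1}"
  shows "((\<lambda>t. h (x + t *\<^sub>R (y - x))) has_derivative
           (\<lambda>d. d * (G (x + t *\<^sub>R (y - x)) \<bullet> (y - x)))) (at t within {0..1})"
proof -
  have seg: "x + t *\<^sub>R (y - x) \<in> X" if "t \<in> {0..1}" for t
    using convexD_alt[OF assms(2,3,4), of t] that by (simp add: algebra_simps)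
  have 1: "((\<lambda>t. x + t *\<^sub>R (y - x)) has_derivative (\<lambda>d. d *\<^sub>R (y - x))) (at t within {0..1})"
    by (auto intro!: derivative_eq_intros)
  have "(h has_derivative (\<lambda>v. G (x + t *\<^sub>R (y - x)) \<bullet> v)) (at (x + t *\<^sub>R (y - x)) within X)"
    using assms(1) seg[OF assms(5)] by (simp add: gradient_on_def)
  then have 2: "(h has_derivative (\<lambda>v. G (x + t *\<^sub>R (y - x)) \<bullet> v))
      (at (x + t *\<^sub>R (y - x)) within (\<lambda>t. x + t *\<^sub>R (y - x)) ` {0..1})"
    by (rule has_derivative_subset) (use seg in auto)
  show ?thesis
    using diff_chain_within[OF 1 2] by (simp add: o_def)
qed

lemma gradient_on_unique_along:
  assumes "gradient_on X h G" "gradient_on X h G'" "convex X" "x \<in> X" "y \<in> X"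
  shows "G x \<bullet> (y - x) = G' x \<bullet> (y - x)"
proof -
  have vd: "((\<lambda>t. h (x + t *\<^sub>R (y - x))) has_vector_derivative H x \<bullet> (y - x)) (at 0 within cbox 0 1)"
    if "gradient_on X h H" for H
    using has_derivative_along_segment[OF that assms(3-5), of 0]
    by (simp add: has_vector_derivative_def)
  show ?thesis
    by (rule vector_derivative_unique_within_closed_interval[OF _ _ vd[OF assms(1)] vd[OF assms(2)]])
      auto
qed

text \<open>
  A gradient on a convex set \<open>X\<close> is unique up to vectors orthogonal to all differences of points
  of \<open>X\<close>.
\<close>

lemma gradient_on_unique:
  assumes "gradient_on X h G" "gradient_on X h G'" "convex X" "x \<in> X" "y \<in> X" "z \<in> X"
  shows "G x \<bullet> (y - z) = G' x \<bullet> (y - z)"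
proof -
  \<comment> \<open>The segments from \<open>x\<close> to \<open>y\<close> and to \<open>z\<close> lie in \<open>X\<close>; the direction \<open>y - z\<close> follows by linearity.\<close>
  have "G x \<bullet> ((y - x) - (z - x)) = G' x \<bullet> ((y - x) - (z - x))"
    unfolding inner_diff_right[of _ "y - x"]
    using gradient_on_unique_along[OF assms(1-4)] assms(5,6) by metis
  then show ?thesis
    by simp
qed

lemma gradient_on_avg_fun:
  assumes "\<And>i. i \<in> {1..n} \<Longrightarrow> gradient_on X (f i) (gf i)"
  shows "gradient_on X (avg_fun n f) (\<lambda>x. (1 / real n) *\<^sub>R (\<Sum>i=1..n. gf i x))"
  unfolding gradient_on_def
proof
  fix x assume x: "x \<in> X"
  have "((\<lambda>x. (1 / real n) * (\<Sum>i=1..n. f i x)) has_derivative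
      (\<lambda>v. (1 / real n) * (\<Sum>i=1..n. gf i x \<bullet> v))) (at x within X)"
    using assms x by (intro has_derivative_mult_right has_derivative_sum) (auto simp: gradient_on_def)
  then show "(avg_fun n f has_derivative (\<lambda>v. ((1 / real n) *\<^sub>R (\<Sum>i=1..n. gf i x)) \<bullet> v)) (at x within X)"
    by (simp add: avg_fun_def[abs_def] inner_sum_left)
qed

lemma smooth_on_descent:
  assumes "smooth_on M X h G" "convex X" "x \<in> X" "y \<in> X"
  shows "h y \<le> h x + G x \<bullet> (y - x) + M / 2 * (norm (y - x))\<^sup>2"
proof -
  define z where "z t = x + t *\<^sub>R (y - x)" for t
  define \<phi> where "\<phi> t = h (z t) - t * (G x \<bullet> (y - x)) - M / 2 * (norm (y - x))\<^sup>2 * t\<^sup>2" for t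
  have grad: "gradient_on X h G"
    and lip: "\<And>u v. u \<in> X \<Longrightarrow> v \<in> X \<Longrightarrow> norm (G u - G v) \<le> M * norm (u - v)"
    using assms(1) by (auto simp: smooth_on_def)
  have seg: "z t \<in> X" if "t \<in> {0..1}" for t
    using convexD_alt[OF assms(2,3,4), of t] that by (simp add: z_def algebra_simps)
  have "(\<phi> has_derivative
      (\<lambda>d. d * (G (z t) \<bullet> (y - x) - G x \<bullet> (y - x) - M * (norm (y - x))\<^sup>2 * t))) (at t within {0..1})"
    if "t \<in> {0..1}" for t
  proof -
    have 1: "((\<lambda>t. h (z t)) has_derivative (\<lambda>d. d * (G (z t) \<bullet> (y - x)))) (at t within {0..1})"
      unfolding z_def by (rule has_derivative_along_segment[OF grad assms(2-4) that])
    have 2: "((\<lambda>t. t * a) has_derivative (\<lambda>d. d * a)) (at t within {0..1})" for a :: real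
      by (auto intro!: derivative_eq_intros)
    have 3: "((\<lambda>t. a * t\<^sup>2) has_derivative (\<lambda>d. d * (2 * a * t))) (at t within {0..1})" for a :: real
      by (auto intro!: derivative_eq_intros)
    show ?thesis
      unfolding \<phi>_def[abs_def]
      by (rule has_derivative_eq_rhs[OF has_derivative_diff[OF has_derivative_diff[OF 1 2] 3]])
        (simp add: algebra_simps)
  qed
  then obtain t where t: "t \<in> {0..1}"
    and mv: "\<phi> 1 - \<phi> 0 = (1 - 0) * (G (z t) \<bullet> (y - x) - G x \<bullet> (y - x) - M * (norm (y - x))\<^sup>2 * t)"
    using mvt_very_simple[of 0 1 \<phi> "\<lambda>t d. d * (G (z t) \<bullet> (y - x) - G x \<bullet> (y - x) - M * (norm (y - x))\<^sup>2 * t)"]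
    by auto
  have "(G (z t) - G x) \<bullet> (y - x) \<le> norm (G (z t) - G x) * norm (y - x)"
    by (rule norm_cauchy_schwarz)
  also have "\<dots> \<le> (M * norm (z t - x)) * norm (y - x)"
    using lip[OF seg[OF t] assms(3)] by (intro mult_right_mono) auto
  also have "\<dots> = M * (norm (y - x))\<^sup>2 * t"
    using t by (simp add: z_def power2_eq_square)
  finally have "\<phi> 1 \<le> \<phi> 0"
    using mv by (simp add: inner_diff_left)
  then show ?thesis
    by (simp add: \<phi>_def z_def)
qed

section \<open>Finitely supported distributions\<close>

lemma expectation_bind_finite:
  fixes h :: "'b \<Rightarrow> 'c::{banach, second_countable_topology}"
  assumes "finite (set_pmf P)" "\<And>x. x \<in> set_pmf P \<Longrightarrow> finite (set_pmf (F x))"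
  shows "measure_pmf.expectation (P \<bind> F) h =
    measure_pmf.expectation P (\<lambda>x. measure_pmf.expectation (F x) h)"
proof -
  have "measure_pmf.expectation (P \<bind> F) h =
      (\<Sum>x\<in>set_pmf P. pmf P x *\<^sub>R measure_pmf.expectation (F x) h)"
    using assms by (rule pmf_expectation_bind) auto
  also have "\<dots> = measure_pmf.expectation P (\<lambda>x. measure_pmf.expectation (F x) h)"
    using assms(1) by (subst integral_measure_pmf[of "set_pmf P"]) auto
  finally show ?thesis .
qed

lemma expectation_pair_bernoulli:
  fixes h :: "bool \<times> 'b \<Rightarrow> real"
  assumes "0 \<le> p" "p \<le> 1" "finite (set_pmf Q)"
  shows "measure_pmf.expectation (pair_pmf (bernoulli_pmf p) Q) h =
    p * measure_pmf.expectation Q (\<lambda>S. h (True, S)) +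
    (1 - p) * measure_pmf.expectation Q (\<lambda>S. h (False, S))"
proof -
  have "measure_pmf.expectation (pair_pmf (bernoulli_pmf p) Q) h =
      measure_pmf.expectation (bernoulli_pmf p) (\<lambda>c. measure_pmf.expectation Q (\<lambda>S. h (c, S)))"
    using assms(3) by (simp add: pair_pmf_def expectation_bind_finite)
  also have "\<dots> = p * measure_pmf.expectation Q (\<lambda>S. h (True, S)) +
      (1 - p) * measure_pmf.expectation Q (\<lambda>S. h (False, S))"
    using assms(1,2) by (subst integral_measure_pmf[of UNIV]) (auto simp: UNIV_bool)
  finally show ?thesis .
qed

lemma finite_set_Pi_pmf:
  assumes "finite A" "\<And>x. x \<in> A \<Longrightarrow> finite (set_pmf (P x))"
  shows "finite (set_pmf (Pi_pmf A d P))"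
  using assms by (simp add: set_Pi_pmf finite_PiE_dflt)

text \<open>
  Drawing one coordinate of a product distribution anew does not change the distribution. If \<open>h w\<close>
  depends only on the coordinates up to \<open>k\<close>, the inner expectation in
  \<open>expectation_Pi_pmf_resample\<close> is the conditional expectation of \<open>h\<close> given the coordinates before \<open>k\<close>.
\<close>

lemma Pi_pmf_resample:
  assumes "finite A" "k \<in> A"
  shows "Pi_pmf A d P = Pi_pmf A d P \<bind> (\<lambda>w. map_pmf (\<lambda>y. w(k := y)) (P k))"
proof -
  define B where "B = A - {k}"
  have A: "A = insert k B" "finite B" "k \<notin> B"
    using assms by (auto simp: B_def)
  have upd: "fun_upd (w(k := y)) k = fun_upd w k" for w :: "'a \<Rightarrow> 'b" and y
    by (simp add: fun_eq_iff)
  have "Pi_pmf A d P \<bind> (\<lambda>w. map_pmf (\<lambda>y. w(k := y)) (P k)) =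
      Pi_pmf B d P \<bind> (\<lambda>w. map_pmf (\<lambda>y. w(k := y)) (P k))"
    by (simp add: A Pi_pmf_insert' bind_assoc_pmf bind_return_pmf upd)
  also have "\<dots> = Pi_pmf A d P"
    unfolding A(1) Pi_pmf_insert'[OF A(2,3)] map_pmf_def by (rule bind_commute_pmf)
  finally show ?thesis ..
qed

lemma expectation_Pi_pmf_resample:
  fixes h :: "_ \<Rightarrow> 'c::{banach, second_countable_topology}"
  assumes "finite A" "\<And>x. x \<in> A \<Longrightarrow> finite (set_pmf (P x))" "k \<in> A"
  shows "measure_pmf.expectation (Pi_pmf A d P) h =
    measure_pmf.expectation (Pi_pmf A d P) (\<lambda>w. measure_pmf.expectation (P k) (\<lambda>y. h (w(k := y))))"
  using assms finite_set_Pi_pmf[of A P d]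
  by (subst Pi_pmf_resample[OF assms(1,3)]) (simp add: expectation_bind_finite)

lemma expectation_norm_sq_iid_sum:
  fixes \<xi> :: "'c \<Rightarrow> 'a::euclidean_space"
  assumes fin: "finite (set_pmf q)" and mean: "measure_pmf.expectation q \<xi> = 0" and "finite J"
  shows "measure_pmf.expectation (Pi_pmf J d (\<lambda>_. q)) (\<lambda>S. (norm (a + (\<Sum>j\<in>J. \<xi> (S j))))\<^sup>2) =
    (norm a)\<^sup>2 + real (card J) * measure_pmf.expectation q (\<lambda>i. (norm (\<xi> i))\<^sup>2)"
  using \<open>finite J\<close>
proof (induction J arbitrary: a rule: finite_induct)
  case empty
  then show ?case by simp
next
  case (insert j J)
  define V where "V = measure_pmf.expectation q (\<lambda>i. (norm (\<xi> i))\<^sup>2)"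
  have int: "integrable (measure_pmf q) h" for h :: "'c \<Rightarrow> 'd::{banach, second_countable_topology}"
    using fin by (rule integrable_measure_pmf_finite)
  have upd: "(\<Sum>i\<in>J. \<xi> ((S(j := y)) i)) = (\<Sum>i\<in>J. \<xi> (S i))" for S y
    using insert.hyps by (intro sum.cong) auto
  have "measure_pmf.expectation (Pi_pmf (insert j J) d (\<lambda>_. q)) (\<lambda>S. (norm (a + (\<Sum>j\<in>insert j J. \<xi> (S j))))\<^sup>2) =
    measure_pmf.expectation q (\<lambda>y. measure_pmf.expectation (Pi_pmf J d (\<lambda>_. q))
       (\<lambda>S. (norm ((a + \<xi> y) + (\<Sum>j\<in>J. \<xi> (S j))))\<^sup>2))"
    using insert.hyps fin
    by (simp add: Pi_pmf_insert' expectation_bind_finite finite_set_Pi_pmf upd fun_upd_same add.assoc del: fun_upd_apply)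
  also have "\<dots> = measure_pmf.expectation q (\<lambda>y. (norm (a + \<xi> y))\<^sup>2 + real (card J) * V)"
    by (simp add: insert.IH V_def)
  also have "\<dots> = measure_pmf.expectation q (\<lambda>y. ((norm a)\<^sup>2 + real (card J) * V) + 2 * (a \<bullet> \<xi> y) + (norm (\<xi> y))\<^sup>2)"
    by (simp add: power2_norm_eq_inner algebra_simps inner_commute)
  also have "\<dots> = (norm a)\<^sup>2 + real (card J) * V + 2 * measure_pmf.expectation q (\<lambda>y. a \<bullet> \<xi> y) + V"
    by (simp add: int V_def)
  also have "measure_pmf.expectation q (\<lambda>y. a \<bullet> \<xi> y) = 0"
    using mean int by (subst integral_inner_right) auto
  finally show ?case
    using insert.hyps by (simp add: V_def algebra_simps)
qed

lemma expectation_le_sqrt_second_moment: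
  fixes h :: "'b \<Rightarrow> real"
  assumes "finite (set_pmf P)"
  shows "measure_pmf.expectation P h \<le> sqrt (measure_pmf.expectation P (\<lambda>x. (h x)\<^sup>2))"
proof (rule real_le_rsqrt)
  have "0 \<le> measure_pmf.variance P h"
    by (rule measure_pmf.variance_positive)
  also have "\<dots> = measure_pmf.expectation P (\<lambda>x. (h x)\<^sup>2) - (measure_pmf.expectation P h)\<^sup>2"
    by (intro measure_pmf.variance_eq integrable_measure_pmf_finite assms)
  finally show "(measure_pmf.expectation P h)\<^sup>2 \<le> measure_pmf.expectation P (\<lambda>x. (h x)\<^sup>2)"
    by simp
qed

section \<open>The distribution of the draws\<close>

text \<open>The draws have finite support, so that every random variable below is integrable.\<close>

lemma set_pmf_index: "n \<ge> 1 \<Longrightarrow> set_pmf (pmf_of_set {1..n}) = {1..n::nat}"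
  by (intro set_pmf_of_set) auto

lemma finite_batch:
  fixes n b :: nat
  assumes "n \<ge> 1"
  shows "finite (set_pmf (Pi_pmf {..<b} 0 (\<lambda>_. pmf_of_set {1..n})))"
  by (rule finite_set_Pi_pmf)
    (simp_all only: set_pmf_index[OF assms] finite_atLeastAtMost finite_lessThan)

lemma finite_round:
  fixes n b :: nat
  assumes "n \<ge> 1"
  shows "finite (set_pmf (pair_pmf (bernoulli_pmf p) (Pi_pmf {..<b} 0 (\<lambda>_. pmf_of_set {1..n}))))"
  unfolding set_pair_pmf
  by (intro finite_cartesian_product finite_batch assms finite_subset[OF subset_UNIV finite_class.finite_UNIV])

lemma finite_draws:
  assumes "n \<ge> 1"
  shows "finite (set_pmf (draws_pmf n p b K))"
  unfolding draws_pmf_def by (intro finite_set_Pi_pmf finite_round assms finite_lessThan)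

lemma expectation_stoch_calls:
  assumes "n \<ge> 1" "0 \<le> p" "p \<le> 1"
  shows "measure_pmf.expectation (draws_pmf n p b K) (\<lambda>\<omega>. real (stoch_calls n b K \<omega>)) =
    real K * (p * real n + (1 - p) * (2 * real b))"
proof -
  define q where "q = pair_pmf (bernoulli_pmf p) (Pi_pmf {..<b} 0 (\<lambda>_. pmf_of_set {1..n}))"
  define cost where "cost y = (if fst y then real n else 2 * real b)" for y :: "bool \<times> (nat \<Rightarrow> nat)"
  have cost: "measure_pmf.expectation (draws_pmf n p b K) (\<lambda>\<omega>. cost (\<omega> k)) =
      p * real n + (1 - p) * (2 * real b)"
    if "k < K" for k
  proof -
    have "measure_pmf.expectation (draws_pmf n p b K) (\<lambda>\<omega>. cost (\<omega> k)) =
        measure_pmf.expectation (map_pmf (\<lambda>\<omega>. \<omega> k) (draws_pmf n p b K)) cost"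
      by simp
    also have "map_pmf (\<lambda>\<omega>. \<omega> k) (draws_pmf n p b K) = q"
      using that by (simp add: draws_pmf_def Pi_pmf_component q_def)
    also have "measure_pmf.expectation q cost = p * real n + (1 - p) * (2 * real b)"
      unfolding q_def using assms by (subst expectation_pair_bernoulli[OF _ _ finite_batch]) (auto simp: cost_def)
    finally show ?thesis .
  qed
  have "measure_pmf.expectation (draws_pmf n p b K) (\<lambda>\<omega>. real (stoch_calls n b K \<omega>)) =
      measure_pmf.expectation (draws_pmf n p b K) (\<lambda>\<omega>. \<Sum>k<K. cost (\<omega> k))"
    by (auto simp: stoch_calls_def cost_def intro!: Bochner_Integration.integral_cong sum.cong)
  also have "\<dots> = (\<Sum>k<K. measure_pmf.expectation (draws_pmf n p b K) (\<lambda>\<omega>. cost (\<omega> k)))"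
    by (intro Bochner_Integration.integral_sum integrable_measure_pmf_finite finite_draws assms(1))
  also have "\<dots> = real K * (p * real n + (1 - p) * (2 * real b))"
    using cost by simp
  finally show ?thesis .
qed

section \<open>The iterates and the error of the gradient estimator\<close>

text \<open>
  A run of the algorithm with a fixed oracle and step sizes in \<open>]0, 1]\<close>. The probability of
  computing a full gradient is not a parameter, as it enters only through the distribution of the
  draws.
\<close>

locale sarah_fw_run =
  fixes X :: "'a::euclidean_space set" and D L :: real and n b :: nat
    and f :: "nat \<Rightarrow> 'a \<Rightarrow> real" and gF :: "'a \<Rightarrow> 'a" and gf :: "nat \<Rightarrow> 'a \<Rightarrow> 'a"
    and Li :: "nat \<Rightarrow> real" and lmo :: "nat \<Rightarrow> 'a \<Rightarrow> 'a" and \<eta> :: "nat \<Rightarrow> real" and x0 :: 'a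
  assumes convex: "convex X"
    and diam: "\<And>x y. x \<in> X \<Longrightarrow> y \<in> X \<Longrightarrow> norm (x - y) \<le> D"
    and n_pos: "n \<ge> 1" and b_pos: "b \<ge> 1"
    and smooth_avg: "smooth_on L X (avg_fun n f) gF"
    and smooth_summand: "\<And>i. i \<in> {1..n} \<Longrightarrow> smooth_on (Li i) X (f i) (gf i)"
    and lmo: "is_lmo X lmo"
    and step: "\<And>k. 0 < \<eta> k" "\<And>k. \<eta> k \<le> 1"
    and x0: "x0 \<in> X"
begin

text \<open>The iterate \<open>x\<^sup>k\<close> and the gradient estimator \<open>g\<^sup>k\<close>, as functions of the draws.\<close>

definition iter :: "draws \<Rightarrow> nat \<Rightarrow> 'a" where
  "iter \<omega> k = fst (sarah_fw gF gf lmo \<eta> b x0 \<omega> k)"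

definition est :: "draws \<Rightarrow> nat \<Rightarrow> 'a" where
  "est \<omega> k = snd (sarah_fw gF gf lmo \<eta> b x0 \<omega> k)"

text \<open>
  A gradient of the average on \<open>X\<close>. It can differ from \<open>gF\<close> by a vector orthogonal to
  the differences of points of \<open>X\<close>.
\<close>

definition mean_grad :: "'a \<Rightarrow> 'a" where
  "mean_grad x = (1 / real n) *\<^sub>R (\<Sum>i=1..n. gf i x)"

text \<open>The mean of the squared Lipschitz constants of the gradients of the summands.\<close>

definition mean_sq_lipschitz :: real where
  "mean_sq_lipschitz = (1 / real n) * (\<Sum>i=1..n. (Li i)\<^sup>2)"

text \<open>
  The deviation of the gradient increment of summand \<open>i\<close> from the mean increment. It has mean zero
  over a uniformly drawn index.
\<close>

definition dev :: "'a \<Rightarrow> 'a \<Rightarrow> nat \<Rightarrow> 'a" where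
  "dev x x' i = (gf i x' - gf i x) - (mean_grad x' - mean_grad x)"

text \<open>
  The accumulated sampling noise since the last computation of a full gradient. The difference
  \<open>g\<^sup>k - gF x\<^sup>k\<close> is not a suitable error: its increments need not be centred, because \<open>gF\<close> can
  differ from \<open>mean_grad\<close>. The increments of \<open>err\<close> from a batch are centred, and \<open>err\<close> has the
  same inner products as that difference with all differences of points of \<open>X\<close>, which are all
  that matter to the analysis.
\<close>

primrec err :: "draws \<Rightarrow> nat \<Rightarrow> 'a" where
  "err \<omega> 0 = 0"
| "err \<omega> (Suc k) = (if fst (\<omega> k) then 0
     else err \<omega> k + (\<Sum>j<b. (1 / real b) *\<^sub>R dev (iter \<omega> k) (iter \<omega> (Suc k)) (snd (\<omega> k) j)))"

lemma D_nonneg: "0 \<le> D"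
  using diam[OF x0 x0] by simp

lemma L_pos: "0 < L"
  using smooth_avg by (simp add: smooth_on_def)

lemma lmo_mem: "lmo k g \<in> X"
  and lmo_le: "v \<in> X \<Longrightarrow> g \<bullet> lmo k g \<le> g \<bullet> v"
proof -
  have "is_arg_min (\<lambda>s. g \<bullet> s) (\<lambda>s. s \<in> X) (lmo k g)"
    using lmo by (simp add: is_lmo_def)
  then show "lmo k g \<in> X" "v \<in> X \<Longrightarrow> g \<bullet> lmo k g \<le> g \<bullet> v"
    by (auto simp: is_arg_min_linorder)
qed

lemma iter_0: "iter \<omega> 0 = x0"
  by (simp add: iter_def)

lemma iter_Suc: "iter \<omega> (Suc k) = iter \<omega> k + \<eta> k *\<^sub>R (lmo k (est \<omega> k) - iter \<omega> k)"
  by (simp add: iter_def est_def Let_def case_prod_beta)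

lemma est_Suc:
  "est \<omega> (Suc k) = (if fst (\<omega> k) then gF (iter \<omega> (Suc k))
     else est \<omega> k + (1 / real b) *\<^sub>R
       (\<Sum>j<b. gf (snd (\<omega> k) j) (iter \<omega> (Suc k)) - gf (snd (\<omega> k) j) (iter \<omega> k)))"
  by (simp add: iter_def est_def Let_def case_prod_beta)

lemma iter_mem: "iter \<omega> k \<in> X"
proof (induction k)
  case 0
  then show ?case by (simp add: iter_0 x0)
next
  case (Suc k)
  then show ?case
    using convexD_alt[OF convex Suc lmo_mem[of k "est \<omega> k"], of "\<eta> k"] step[of k]
    by (simp add: iter_Suc algebra_simps)
qed

lemma norm_iter_diff: "norm (iter \<omega> (Suc k) - iter \<omega> k) \<le> \<eta> k * D"
  using diam[OF lmo_mem iter_mem] step(1)[of k] by (simp add: iter_Suc)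

lemma state_cong:
  assumes "\<And>j. j < k \<Longrightarrow> \<omega> j = \<omega>' j"
  shows "sarah_fw gF gf lmo \<eta> b x0 \<omega> k = sarah_fw gF gf lmo \<eta> b x0 \<omega>' k"
  using assms by (induction k) auto

lemma iter_upd: "k \<le> j \<Longrightarrow> iter ((\<omega>)(j := y)) k = iter \<omega> k"
  and est_upd: "k \<le> j \<Longrightarrow> est ((\<omega>)(j := y)) k = est \<omega> k"
  using state_cong[of k "(\<omega>)(j := y)" \<omega>] by (simp_all add: iter_def est_def)

lemma err_upd: "k \<le> j \<Longrightarrow> err ((\<omega>)(j := y)) k = err \<omega> k"
proof (induction k)
  case (Suc k)
  then show ?case
    using iter_upd[of "Suc k" j \<omega> y] iter_upd[of k j \<omega> y] by (simp del: fun_upd_apply) simp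
qed simp

lemma mean_grad_inner:
  assumes "x \<in> X" "y \<in> X" "z \<in> X"
  shows "mean_grad x \<bullet> (y - z) = gF x \<bullet> (y - z)"
proof -
  have "gradient_on X (avg_fun n f) mean_grad"
    using gradient_on_avg_fun[of n X f gf] smooth_summand
    by (simp add: mean_grad_def[abs_def] smooth_on_def)
  moreover have "gradient_on X (avg_fun n f) gF"
    using smooth_avg by (simp add: smooth_on_def)
  ultimately show ?thesis
    using gradient_on_unique[OF _ _ convex assms] by blast
qed

lemma est_error_inner:
  assumes "y \<in> X" "z \<in> X"
  shows "(est \<omega> k - gF (iter \<omega> k)) \<bullet> (y - z) = err \<omega> k \<bullet> (y - z)"
proof (induction k)
  case 0
  then show ?case by (simp add: iter_def est_def)
next
  case (Suc k)
  define x x' where "x = iter \<omega> k" and "x' = iter \<omega> (Suc k)"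
  define B where "B = (\<Sum>j<b. gf (snd (\<omega> k) j) x' - gf (snd (\<omega> k) j) x)"
  have "(\<Sum>j<b. (1 / real b) *\<^sub>R dev x x' (snd (\<omega> k) j)) =
      (1 / real b) *\<^sub>R (B - real b *\<^sub>R (mean_grad x' - mean_grad x))"
    unfolding B_def dev_def scaleR_sum_right[symmetric]
    by (simp add: sum_subtractf scaleR_diff_right sum_constant_scaleR)
  also have "\<dots> = (1 / real b) *\<^sub>R B - (mean_grad x' - mean_grad x)"
    using b_pos by (simp add: scaleR_diff_right)
  finally have dev: "(\<Sum>j<b. (1 / real b) *\<^sub>R dev x x' (snd (\<omega> k) j)) =
      (1 / real b) *\<^sub>R B - (mean_grad x' - mean_grad x)" .
  have mem: "x \<in> X" "x' \<in> X"
    by (simp_all add: x_def x'_def iter_mem)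
  show ?case
  proof (cases "fst (\<omega> k)")
    case True
    then show ?thesis by (simp add: est_Suc)
  next
    case False
    have "(est \<omega> (Suc k) - gF x') \<bullet> (y - z) =
        (est \<omega> k - gF x) \<bullet> (y - z) + ((1 / real b) *\<^sub>R B) \<bullet> (y - z) - (gF x' - gF x) \<bullet> (y - z)"
      using False unfolding est_Suc x_def[symmetric] x'_def[symmetric] B_def[symmetric]
      by (simp only: if_False inner_diff_left inner_add_left)
    also have "\<dots> = (err \<omega> k + ((1 / real b) *\<^sub>R B - (mean_grad x' - mean_grad x))) \<bullet> (y - z)"
      using Suc mean_grad_inner[OF mem(1) assms] mean_grad_inner[OF mem(2) assms]
      unfolding x_def[symmetric] by (simp only: inner_diff_left inner_add_left)
    also have "\<dots> = err \<omega> (Suc k) \<bullet> (y - z)"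
      using False dev by (simp add: x_def x'_def)
    finally show ?thesis
      by (simp add: x'_def)
  qed
qed

section \<open>The progress of one iteration\<close>

text \<open>
  Smoothness bounds the decrease of the objective by its linear model at \<open>x\<^sup>k\<close>. The oracle optimizes
  for \<open>g\<^sup>k\<close> instead of the gradient, which costs at most \<open>D\<close> times the norm of the error.
\<close>

lemma gap_step:
  "\<eta> k * fw_gap X gF (iter \<omega> k) \<le>
     avg_fun n f (iter \<omega> k) - avg_fun n f (iter \<omega> (Suc k)) +
     \<eta> k * D * norm (err \<omega> k) + L / 2 * (\<eta> k * D)\<^sup>2"
    (is "_ \<le> ?R")
proof -
  define x s where "x = iter \<omega> k" and "s = lmo k (est \<omega> k)"
  have x: "x \<in> X" and s: "s \<in> X"
    by (simp_all add: x_def s_def iter_mem lmo_mem)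
  have "avg_fun n f (iter \<omega> (Suc k)) \<le> avg_fun n f x +
      gF x \<bullet> (iter \<omega> (Suc k) - x) + L / 2 * (norm (iter \<omega> (Suc k) - x))\<^sup>2"
    using smooth_avg convex x iter_mem by (rule smooth_on_descent)
  also have "\<dots> \<le> avg_fun n f x + gF x \<bullet> (iter \<omega> (Suc k) - x) + L / 2 * (\<eta> k * D)\<^sup>2"
    using L_pos norm_iter_diff[of \<omega> k]
    by (intro add_left_mono mult_left_mono power_mono) (auto simp: x_def)
  also have "gF x \<bullet> (iter \<omega> (Suc k) - x) = \<eta> k * (gF x \<bullet> (s - x))"
    by (simp add: iter_Suc x_def s_def)
  finally have descent: "avg_fun n f (iter \<omega> (Suc k)) \<le>
      avg_fun n f x + \<eta> k * (gF x \<bullet> (s - x)) + L / 2 * (\<eta> k * D)\<^sup>2" .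
  have "gF x \<bullet> (x - v) \<le> ?R / \<eta> k" if v: "v \<in> X" for v
  proof -
    have "gF x \<bullet> (s - v) = est \<omega> k \<bullet> (s - v) - err \<omega> k \<bullet> (s - v)"
      using est_error_inner[OF s v, of \<omega> k] by (simp add: x_def inner_diff_left)
    also have "\<dots> \<le> - (err \<omega> k \<bullet> (s - v))"
      using lmo_le[OF v, of "est \<omega> k" k] by (simp add: s_def inner_diff_right)
    also have "\<dots> \<le> norm (err \<omega> k) * norm (s - v)"
      using Cauchy_Schwarz_ineq2[of "err \<omega> k" "s - v"] by linarith
    also have "\<dots> \<le> norm (err \<omega> k) * D"
      using diam[OF s v] by (intro mult_left_mono) auto
    finally have "gF x \<bullet> (x - v) \<le> D * norm (err \<omega> k) - gF x \<bullet> (s - x)"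
      by (simp add: inner_diff_right mult.commute)
    then have "\<eta> k * (gF x \<bullet> (x - v)) \<le> \<eta> k * (D * norm (err \<omega> k) - gF x \<bullet> (s - x))"
      using step(1)[of k] by (intro mult_left_mono) auto
    then have "\<eta> k * (gF x \<bullet> (x - v)) \<le> ?R"
      using descent by (simp add: x_def algebra_simps)
    then show ?thesis
      using step(1)[of k] by (simp add: pos_le_divide_eq mult.commute)
  qed
  then have "fw_gap X gF x \<le> ?R / \<eta> k"
    unfolding fw_gap_def using x0 by (intro cSUP_least) auto
  then show ?thesis
    using step(1)[of k] by (simp add: pos_le_divide_eq mult.commute x_def)
qed

section \<open>The second moment of the error\<close>

lemma expectation_dev: "measure_pmf.expectation (pmf_of_set {1..n}) (dev x x') = 0"
proof -
  have "(\<Sum>i=1..n. dev x x' i) = (\<Sum>i=1..n. gf i x') - (\<Sum>i=1..n. gf i x) - real n *\<^sub>R (mean_grad x' - mean_grad x)"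
    by (simp add: dev_def sum_subtractf sum_constant_scaleR scaleR_diff_right)
  also have "\<dots> = 0"
    using n_pos by (simp add: mean_grad_def scaleR_diff_right)
  finally have sum: "(\<Sum>i=1..n. dev x x' i) = 0" .
  have "measure_pmf.expectation (pmf_of_set {1..n}) (dev x x') =
      (\<Sum>i=1..n. pmf (pmf_of_set {1..n}) i *\<^sub>R dev x x' i)"
    using set_pmf_index[OF n_pos] by (intro integral_measure_pmf) auto
  also have "\<dots> = (\<Sum>i=1..n. (1 / real n) *\<^sub>R dev x x' i)"
    using n_pos by (intro sum.cong) auto
  also have "\<dots> = 0"
    using sum by (simp flip: scaleR_sum_right)
  finally show ?thesis .
qed

lemma expectation_norm_sq_dev:
  assumes "x \<in> X" "x' \<in> X"
  shows "measure_pmf.expectation (pmf_of_set {1..n}) (\<lambda>i. (norm (dev x x' i))\<^sup>2) \<le>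
    mean_sq_lipschitz * (norm (x' - x))\<^sup>2"
proof -
  define \<Delta> where "\<Delta> i = gf i x' - gf i x" for i
  define m where "m = mean_grad x' - mean_grad x"
  have sum_\<Delta>: "(\<Sum>i=1..n. \<Delta> i) = real n *\<^sub>R m"
    using n_pos by (simp add: \<Delta>_def m_def mean_grad_def sum_subtractf scaleR_diff_right)
  have "(\<Sum>i=1..n. (norm (dev x x' i))\<^sup>2) = (\<Sum>i=1..n. (norm (\<Delta> i))\<^sup>2 - 2 * (\<Delta> i \<bullet> m) + m \<bullet> m)"
    by (intro sum.cong) (auto simp: dev_def \<Delta>_def m_def power2_norm_eq_inner inner_diff inner_commute)
  also have "\<dots> = (\<Sum>i=1..n. (norm (\<Delta> i))\<^sup>2) - 2 * ((\<Sum>i=1..n. \<Delta> i) \<bullet> m) + real n * (m \<bullet> m)"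
    by (simp add: sum.distrib sum_subtractf sum_distrib_left inner_sum_left)
  also have "\<dots> \<le> (\<Sum>i=1..n. (norm (\<Delta> i))\<^sup>2)"
    unfolding sum_\<Delta> by simp
  also have "\<dots> \<le> (\<Sum>i=1..n. (Li i * norm (x' - x))\<^sup>2)"
    using smooth_summand assms by (intro sum_mono power_mono) (auto simp: \<Delta>_def smooth_on_def)
  also have "\<dots> = (\<Sum>i=1..n. (Li i)\<^sup>2) * (norm (x' - x))\<^sup>2"
    by (simp add: power_mult_distrib sum_distrib_right)
  finally show ?thesis
    using n_pos by (subst integral_pmf_of_set) (auto simp: mean_sq_lipschitz_def divide_right_mono)
qed

lemma expectation_norm_sq_batch:
  assumes "x \<in> X" "x' \<in> X"
  shows "measure_pmf.expectation (Pi_pmf {..<b} 0 (\<lambda>_. pmf_of_set {1..n}))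
      (\<lambda>S. (norm (a + (\<Sum>j<b. (1 / real b) *\<^sub>R dev x x' (S j))))\<^sup>2) \<le>
    (norm a)\<^sup>2 + mean_sq_lipschitz * (norm (x' - x))\<^sup>2 / real b"
proof -
  let ?q = "pmf_of_set {1..n}"
  have "measure_pmf.expectation (Pi_pmf {..<b} 0 (\<lambda>_. ?q))
      (\<lambda>S. (norm (a + (\<Sum>j<b. (1 / real b) *\<^sub>R dev x x' (S j))))\<^sup>2) =
    (norm a)\<^sup>2 + real (card {..<b}) * measure_pmf.expectation ?q (\<lambda>i. (norm ((1 / real b) *\<^sub>R dev x x' i))\<^sup>2)"
    by (rule expectation_norm_sq_iid_sum) (use set_pmf_index[OF n_pos] expectation_dev in simp_all)
  also have "\<dots> = (norm a)\<^sup>2 + measure_pmf.expectation ?q (\<lambda>i. (norm (dev x x' i))\<^sup>2) / real b"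
    using b_pos by (simp add: power_divide power2_eq_square)
  finally show ?thesis
    using expectation_norm_sq_dev[OF assms] by (simp add: divide_right_mono)
qed

text \<open>
  With probability \<open>p\<close> the error is reset to \<open>0\<close>. Otherwise it receives independent centred
  increments, whose second moments add up.
\<close>

lemma second_moment_step:
  assumes p: "0 \<le> p" "p \<le> 1" and k: "k < K"
  shows "measure_pmf.expectation (draws_pmf n p b K) (\<lambda>\<omega>. (norm (err \<omega> (Suc k)))\<^sup>2) \<le>
    (1 - p) * (measure_pmf.expectation (draws_pmf n p b K) (\<lambda>\<omega>. (norm (err \<omega> k))\<^sup>2) +
      mean_sq_lipschitz * (\<eta> k * D)\<^sup>2 / real b)"
proof -
  let ?E = "measure_pmf.expectation (draws_pmf n p b K)"
  let ?Q = "Pi_pmf {..<b} 0 (\<lambda>_. pmf_of_set {1..n})"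
  let ?q = "pair_pmf (bernoulli_pmf p) ?Q"
  define c where "c = mean_sq_lipschitz * (\<eta> k * D)\<^sup>2 / real b"
  have finQ: "finite (set_pmf ?Q)"
    by (rule finite_batch[OF n_pos])
  have lip: "0 \<le> mean_sq_lipschitz"
    by (auto simp: mean_sq_lipschitz_def intro!: sum_nonneg divide_nonneg_nonneg)
  \<comment> \<open>The draws before round \<open>k\<close> fix both end points of the step; only the flag and the batch vary.\<close>
  have inner: "measure_pmf.expectation ?q (\<lambda>y. (norm (err ((\<omega>)(k := y)) (Suc k)))\<^sup>2) \<le>
      (1 - p) * ((norm (err \<omega> k))\<^sup>2 + c)" for \<omega>
  proof -
    define x x' where "x = iter \<omega> k" and "x' = iter \<omega> (Suc k)"
    have mem: "x \<in> X" "x' \<in> X"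
      by (simp_all add: x_def x'_def iter_mem)
    have upd: "iter ((\<omega>)(k := y)) (Suc k) = x'" "iter ((\<omega>)(k := y)) k = x" "err ((\<omega>)(k := y)) k = err \<omega> k" for y
      by (simp_all add: x_def x'_def iter_Suc iter_upd est_upd err_upd)
    have "measure_pmf.expectation ?q (\<lambda>y. (norm (err ((\<omega>)(k := y)) (Suc k)))\<^sup>2) =
      (1 - p) * measure_pmf.expectation ?Q
        (\<lambda>S. (norm (err \<omega> k + (\<Sum>j<b. (1 / real b) *\<^sub>R dev x x' (S j))))\<^sup>2)"
      unfolding err.simps upd fun_upd_same
      by (subst expectation_pair_bernoulli[OF p finQ]) simp
    also have "\<dots> \<le> (1 - p) * ((norm (err \<omega> k))\<^sup>2 + mean_sq_lipschitz * (norm (x' - x))\<^sup>2 / real b)"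
      using p by (intro mult_left_mono expectation_norm_sq_batch mem) auto
    also have "\<dots> \<le> (1 - p) * ((norm (err \<omega> k))\<^sup>2 + c)"
      unfolding c_def using p lip norm_iter_diff[of \<omega> k]
      by (intro mult_left_mono add_left_mono divide_right_mono power_mono) (auto simp: x_def x'_def)
    finally show ?thesis .
  qed
  have int: "integrable (measure_pmf (draws_pmf n p b K)) h" for h :: "draws \<Rightarrow> real"
    by (rule integrable_measure_pmf_finite[OF finite_draws[OF n_pos]])
  have "?E (\<lambda>\<omega>. (norm (err \<omega> (Suc k)))\<^sup>2) =
      ?E (\<lambda>\<omega>. measure_pmf.expectation ?q (\<lambda>y. (norm (err ((\<omega>)(k := y)) (Suc k)))\<^sup>2))"
    unfolding draws_pmf_def using k
    by (intro expectation_Pi_pmf_resample finite_round n_pos finite_lessThan) simp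
  also have "\<dots> \<le> ?E (\<lambda>\<omega>. (1 - p) * ((norm (err \<omega> k))\<^sup>2 + c))"
    by (intro integral_mono int inner)
  also have "\<dots> = (1 - p) * (?E (\<lambda>\<omega>. (norm (err \<omega> k))\<^sup>2) + c)"
    by (simp add: int)
  finally show ?thesis
    by (simp add: c_def)
qed

text \<open>
  The bound is the fixed point of the recursion \<open>second_moment_step\<close>; the second moments start at \<open>0\<close>,
  below it.
\<close>

lemma second_moment_bound:
  assumes p: "0 < p" "p \<le> 1" and k: "k \<le> K" and const: "\<And>k. \<eta> k = h"
  shows "measure_pmf.expectation (draws_pmf n p b K) (\<lambda>\<omega>. (norm (err \<omega> k))\<^sup>2) \<le>
    (1 - p) / p * (mean_sq_lipschitz * (h * D)\<^sup>2 / real b)"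
  using k
proof (induction k)
  case 0
  have "0 \<le> mean_sq_lipschitz"
    by (auto simp: mean_sq_lipschitz_def intro!: sum_nonneg divide_nonneg_nonneg)
  then show ?case
    using p by simp
next
  case (Suc k)
  define c where "c = mean_sq_lipschitz * (h * D)\<^sup>2 / real b"
  let ?E = "measure_pmf.expectation (draws_pmf n p b K)"
  have "?E (\<lambda>\<omega>. (norm (err \<omega> (Suc k)))\<^sup>2) \<le> (1 - p) * (?E (\<lambda>\<omega>. (norm (err \<omega> k))\<^sup>2) + c)"
    using second_moment_step[of p k K] p Suc.prems by (simp add: const c_def)
  also have "\<dots> \<le> (1 - p) * ((1 - p) / p * c + c)"
    using Suc p by (intro mult_left_mono add_right_mono) (auto simp: c_def)
  also have "\<dots> = (1 - p) / p * c"
    using p by (simp add: field_simps)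
  finally show ?case
    by (simp add: c_def)
qed

section \<open>Convergence rate\<close>

lemma expectation_min_gap_le:
  assumes p: "0 < p" "p \<le> 1" and K: "K \<ge> 1" and const: "\<And>k. \<eta> k = h"
    and min: "\<And>x. x \<in> X \<Longrightarrow> F \<le> avg_fun n f x"
  shows "measure_pmf.expectation (draws_pmf n p b K) (min_gap X gF gf lmo \<eta> b x0 K) \<le>
    (avg_fun n f x0 - F) / (real K * h) + L / 2 * h * D\<^sup>2 +
    D * sqrt ((1 - p) / p * (mean_sq_lipschitz * (h * D)\<^sup>2 / real b))"
proof -
  let ?E = "measure_pmf.expectation (draws_pmf n p b K)"
  define \<sigma> where "\<sigma> = sqrt ((1 - p) / p * (mean_sq_lipschitz * (h * D)\<^sup>2 / real b))"
  have h: "0 < h"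
    using step(1)[of 0] const by simp
  have int: "integrable (measure_pmf (draws_pmf n p b K)) g" for g :: "draws \<Rightarrow> real"
    by (rule integrable_measure_pmf_finite[OF finite_draws[OF n_pos]])
  have path: "min_gap X gF gf lmo \<eta> b x0 K \<omega> \<le>
      (avg_fun n f x0 - F) / (real K * h) + L / 2 * h * D\<^sup>2 + D / real K * (\<Sum>k<K. norm (err \<omega> k))" for \<omega>
  proof -
    let ?m = "min_gap X gF gf lmo \<eta> b x0 K \<omega>"
    have "real K * (h * ?m) = (\<Sum>k<K. h * ?m)"
      by simp
    also have "\<dots> \<le> (\<Sum>k<K. h * fw_gap X gF (iter \<omega> k))"
      using h by (intro sum_mono mult_left_mono) (auto simp: min_gap_def iter_def)
    also have "\<dots> \<le> (\<Sum>k<K. avg_fun n f (iter \<omega> k) - avg_fun n f (iter \<omega> (Suc k)) +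
        h * D * norm (err \<omega> k) + L / 2 * (h * D)\<^sup>2)"
      using gap_step[of _ \<omega>] by (intro sum_mono) (simp add: const)
    also have "\<dots> = avg_fun n f x0 - avg_fun n f (iter \<omega> K) +
        h * D * (\<Sum>k<K. norm (err \<omega> k)) + real K * (L / 2 * (h * D)\<^sup>2)"
      using sum_lessThan_telescope'[of "\<lambda>k. avg_fun n f (iter \<omega> k)" K]
      by (simp add: sum.distrib sum_distrib_left iter_0)
    also have "\<dots> \<le> avg_fun n f x0 - F +
        h * D * (\<Sum>k<K. norm (err \<omega> k)) + real K * (L / 2 * (h * D)\<^sup>2)"
      using min[OF iter_mem] by simp
    finally have "?m \<le> (avg_fun n f x0 - F +
        h * D * (\<Sum>k<K. norm (err \<omega> k)) + real K * (L / 2 * (h * D)\<^sup>2)) / (real K * h)"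
      using h K by (simp add: pos_le_divide_eq algebra_simps)
    also have "\<dots> = (avg_fun n f x0 - F) / (real K * h) + L / 2 * h * D\<^sup>2 + D / real K * (\<Sum>k<K. norm (err \<omega> k))"
      using h K by (simp add: add_divide_distrib power2_eq_square)
    finally show ?thesis .
  qed
  have "?E (min_gap X gF gf lmo \<eta> b x0 K) \<le>
      ?E (\<lambda>\<omega>. (avg_fun n f x0 - F) / (real K * h) + L / 2 * h * D\<^sup>2 + D / real K * (\<Sum>k<K. norm (err \<omega> k)))"
    by (intro integral_mono int path)
  also have "\<dots> = (avg_fun n f x0 - F) / (real K * h) + L / 2 * h * D\<^sup>2 +
      D / real K * (\<Sum>k<K. ?E (\<lambda>\<omega>. norm (err \<omega> k)))"
    using int by simp
  also have "\<dots> \<le> (avg_fun n f x0 - F) / (real K * h) + L / 2 * h * D\<^sup>2 + D / real K * (\<Sum>k<K. \<sigma>)"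
  proof -
    have "?E (\<lambda>\<omega>. norm (err \<omega> k)) \<le> \<sigma>" if "k < K" for k
    proof -
      have "?E (\<lambda>\<omega>. norm (err \<omega> k)) \<le> sqrt (?E (\<lambda>\<omega>. (norm (err \<omega> k))\<^sup>2))"
        by (rule expectation_le_sqrt_second_moment[OF finite_draws[OF n_pos]])
      also have "\<dots> \<le> \<sigma>"
        unfolding \<sigma>_def using that
        by (intro real_sqrt_le_mono second_moment_bound p const) auto
      finally show ?thesis .
    qed
    then show ?thesis
      using D_nonneg by (intro add_left_mono mult_left_mono sum_mono) auto
  qed
  also have "D / real K * (\<Sum>k<K. \<sigma>) = D * \<sigma>"
    using K by simp
  finally show ?thesis
    by (simp add: \<sigma>_def)
qed

end

section \<open>The number of iterations\<close>

text \<open>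
  The number of iterations must be at least \<open>3 T\<close> for the required accuracy. Unless it is \<open>1\<close>, it
  must be at most \<open>6 T\<close> for the bound \<open>24 b T\<close> on the expected number of gradient evaluations, as an
  iteration costs up to \<open>4 b\<close> of them on average.
\<close>

lemma iteration_count_exists:
  fixes T :: real
  assumes "0 \<le> T"
  obtains K :: nat where "K \<ge> 1" "3 * T \<le> real K" "K = 1 \<or> real K \<le> 6 * T"
proof (cases "6 * T < 2")
  case True
  then show ?thesis using that[of 1] by simp
next
  case False
  then have "2 \<le> \<lfloor>6 * T\<rfloor>"
    by linarith
  moreover have "3 * T \<le> of_int \<lfloor>6 * T\<rfloor>" "of_int \<lfloor>6 * T\<rfloor> \<le> 6 * T"
    using False by linarith+
  ultimately show ?thesis
    using that[of "nat \<lfloor>6 * T\<rfloor>"] by simp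
qed

lemma rate_le_sqrt:
  fixes A B c K :: real
  assumes "0 \<le> c" "3 * (A\<^sup>2 + B\<^sup>2 * (1 + c)) \<le> K"
  shows "A + B / 2 + B * sqrt (c / 2) \<le> sqrt K"
proof (rule real_le_rsqrt)
  define w where "w = B * sqrt (c / 2)"
  have w: "w\<^sup>2 = B\<^sup>2 * c / 2"
    using assms(1) by (simp add: w_def power_mult_distrib)
  have "3 * (A\<^sup>2 + (B / 2)\<^sup>2 + w\<^sup>2) - (A + B / 2 + w)\<^sup>2 = (A - B / 2)\<^sup>2 + (A - w)\<^sup>2 + (B / 2 - w)\<^sup>2"
    by (simp add: power2_eq_square algebra_simps)
  then have "(A + B / 2 + w)\<^sup>2 \<le> 3 * (A\<^sup>2 + (B / 2)\<^sup>2 + w\<^sup>2)"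
    using zero_le_power2[of "A - B / 2"] zero_le_power2[of "A - w"] zero_le_power2[of "B / 2 - w"]
    by linarith
  also have "\<dots> \<le> 3 * (A\<^sup>2 + B\<^sup>2 * (1 + c))"
  proof -
    have "0 \<le> B\<^sup>2 * c" "0 \<le> B\<^sup>2" "(B / 2)\<^sup>2 = B\<^sup>2 / 4"
      using assms(1) by (auto simp: power_divide)
    then show ?thesis
      unfolding w distrib_left by linarith
  qed
  finally show "(A + B / 2 + B * sqrt (c / 2))\<^sup>2 \<le> K"
    using assms(2) by (simp add: w_def)
qed

theorem corollary4p4:
  fixes X :: "'a::euclidean_space set"
    and D L Lt p h0 \<epsilon> :: real
    and n b :: nat
    and f :: "nat \<Rightarrow> 'a \<Rightarrow> real"
    and gF :: "'a \<Rightarrow> 'a"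
    and gf :: "nat \<Rightarrow> 'a \<Rightarrow> 'a"
    and Li :: "nat \<Rightarrow> real"
    and x0 xmin :: 'a
  assumes "convex X" and "compact X"
    and "\<And>x y. x \<in> X \<Longrightarrow> y \<in> X \<Longrightarrow> norm (x - y) \<le> D"
    and "n \<ge> 1" and "b \<ge> 1"
    and "smooth_on L X (avg_fun n f) gF"
    and "\<And>i. i \<in> {1..n} \<Longrightarrow> smooth_on (Li i) X (f i) (gf i)"
    and "Lt\<^sup>2 = (1 / real n) * (\<Sum>i=1..n. (Li i)\<^sup>2)"
    and "is_arg_min (avg_fun n f) (\<lambda>x. x \<in> X) xmin"
    and "x0 \<in> X"
    and "h0 = avg_fun n f x0 - avg_fun n f xmin"
    and "p = 2 * real b / (real n + 2 * real b)"
    and "\<epsilon> > 0"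
  shows "\<exists>K\<ge>1.
      real K \<le> max 1 (complexity_const *
        ((h0 / \<epsilon>)\<^sup>2 + (L * D\<^sup>2 / \<epsilon>)\<^sup>2 * (1 + Lt\<^sup>2 * real n / (L\<^sup>2 * (real b)\<^sup>2)))) \<and>
      measure_pmf.expectation (draws_pmf n p b K) (\<lambda>\<omega>. real (stoch_calls n b K \<omega>))
        \<le> max (p * real n + (1 - p) * (2 * real b)) (complexity_const *
        (real b * (h0 / \<epsilon>)\<^sup>2 + (L * D\<^sup>2 / \<epsilon>)\<^sup>2 * (real b + Lt\<^sup>2 * real n / (L\<^sup>2 * real b)))) \<and>
      (\<forall>lmo. is_lmo X lmo \<longrightarrow>
        measure_pmf.expectation (draws_pmf n p b K)
          (min_gap X gF gf lmo (\<lambda>k. 1 / sqrt (real K)) b x0 K) \<le> \<epsilon>)"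
proof -
  define A B c T where "A = h0 / \<epsilon>" and "B = L * D\<^sup>2 / \<epsilon>"
    and "c = Lt\<^sup>2 * real n / (L\<^sup>2 * (real b)\<^sup>2)" and "T = A\<^sup>2 + B\<^sup>2 * (1 + c)"
  have L: "0 < L" and b: "0 < real b" and n: "0 < real n"
    using assms(4-6) by (auto simp: smooth_on_def)
  have c: "0 \<le> c"
    by (simp add: c_def)
  have "0 \<le> T"
    using c by (simp add: T_def)
  then obtain K :: nat where K: "K \<ge> 1" "3 * T \<le> real K" "K = 1 \<or> real K \<le> 6 * T"
    by (rule iteration_count_exists)
  have p: "0 < p" "p \<le> 1"
    using b n by (auto simp: assms(12) field_simps)
  have q: "1 - p = real n / (real n + 2 * real b)"
    using b n by (simp add: assms(12) field_simps)
  have odds: "(1 - p) / p = real n / (2 * real b)"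
    using b n unfolding q by (simp add: assms(12))
  have "p * real n + (1 - p) * (2 * real b) = 4 * real b * (real n / (real n + 2 * real b))"
    unfolding q by (simp add: assms(12))
  also have "\<dots> \<le> 4 * real b"
    using b n by (intro mult_left_le) auto
  finally have cost: "p * real n + (1 - p) * (2 * real b) \<le> 4 * real b" .
  have "real K \<le> max 1 (complexity_const * T)"
    using K(3) \<open>0 \<le> T\<close> by (auto simp: complexity_const_def)
  moreover have "measure_pmf.expectation (draws_pmf n p b K) (\<lambda>\<omega>. real (stoch_calls n b K \<omega>))
      \<le> max (p * real n + (1 - p) * (2 * real b)) (complexity_const *
        (real b * (h0 / \<epsilon>)\<^sup>2 + (L * D\<^sup>2 / \<epsilon>)\<^sup>2 * (real b + Lt\<^sup>2 * real n / (L\<^sup>2 * real b))))"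
    using K(3)
  proof
    assume "K = 1"
    then show ?thesis
      using p by (simp add: expectation_stoch_calls[OF assms(4)])
  next
    assume "real K \<le> 6 * T"
    have "measure_pmf.expectation (draws_pmf n p b K) (\<lambda>\<omega>. real (stoch_calls n b K \<omega>)) =
        real K * (p * real n + (1 - p) * (2 * real b))"
      using p by (simp add: expectation_stoch_calls[OF assms(4)])
    also have "\<dots> \<le> (6 * T) * (4 * real b)"
      using \<open>real K \<le> 6 * T\<close> \<open>0 \<le> T\<close> cost p b n by (intro mult_mono) auto
    also have "\<dots> = complexity_const * (real b * A\<^sup>2 + B\<^sup>2 * (real b + real b * c))"
      by (simp add: complexity_const_def T_def algebra_simps)
    also have "real b * c = Lt\<^sup>2 * real n / (L\<^sup>2 * real b)"
      using b by (simp add: c_def power2_eq_square)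
    finally show ?thesis
      by (simp add: A_def B_def)
  qed
  moreover have "measure_pmf.expectation (draws_pmf n p b K)
      (min_gap X gF gf lmo (\<lambda>k. 1 / sqrt (real K)) b x0 K) \<le> \<epsilon>" if "is_lmo X lmo" for lmo
  proof -
    define h where "h = 1 / sqrt (real K)"
    have h: "0 < h" "h \<le> 1"
      using K(1) by (simp_all add: h_def)
    interpret sarah_fw_run X D L n b f gF gf Li lmo "\<lambda>_. h" x0
      using assms that h by unfold_locales auto
    have "measure_pmf.expectation (draws_pmf n p b K) (min_gap X gF gf lmo (\<lambda>_. h) b x0 K) \<le>
        (avg_fun n f x0 - avg_fun n f xmin) / (real K * h) + L / 2 * h * D\<^sup>2 +
        D * sqrt ((1 - p) / p * (mean_sq_lipschitz * (h * D)\<^sup>2 / real b))"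
      using p K(1) assms(9) by (intro expectation_min_gap_le) (auto simp: is_arg_min_linorder)
    also have "(avg_fun n f x0 - avg_fun n f xmin) / (real K * h) = h * (\<epsilon> * A)"
    proof -
      have "real K * h = sqrt (real K)"
        by (simp add: h_def real_div_sqrt)
      then show ?thesis
        using assms(13) by (simp add: A_def h_def assms(11))
    qed
    also have "L / 2 * h * D\<^sup>2 = h * (\<epsilon> * (B / 2))"
      using assms(13) by (simp add: B_def)
    also have "D * sqrt ((1 - p) / p * (mean_sq_lipschitz * (h * D)\<^sup>2 / real b)) = h * (\<epsilon> * (B * sqrt (c / 2)))"
    proof -
      have "mean_sq_lipschitz = Lt\<^sup>2"
        by (simp only: mean_sq_lipschitz_def assms(8))
      then have "(1 - p) / p * (mean_sq_lipschitz * (h * D)\<^sup>2 / real b) = (h * D * L)\<^sup>2 * (c / 2)"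
        using L b n unfolding odds by (simp add: c_def power2_eq_square mult_ac)
      moreover have "sqrt ((h * D * L)\<^sup>2 * (c / 2)) = h * D * L * sqrt (c / 2)"
        unfolding real_sqrt_mult[of "(h * D * L)\<^sup>2"] using D_nonneg L h by simp
      ultimately have "D * sqrt ((1 - p) / p * (mean_sq_lipschitz * (h * D)\<^sup>2 / real b)) =
          D * (h * D * L * sqrt (c / 2))"
        by (simp only:)
      then show ?thesis
        using assms(13) by (simp add: B_def power2_eq_square mult_ac)
    qed
    also have "h * (\<epsilon> * A) + h * (\<epsilon> * (B / 2)) + h * (\<epsilon> * (B * sqrt (c / 2))) =
        \<epsilon> * h * (A + B / 2 + B * sqrt (c / 2))"
      by (simp add: algebra_simps)
    also have "\<dots> \<le> \<epsilon> * h * sqrt (real K)"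
      using rate_le_sqrt[OF c, of A B "real K"] K(2) assms(13) h
      by (intro mult_left_mono) (auto simp: T_def)
    also have "\<dots> = \<epsilon>"
      using K(1) by (simp add: h_def)
    finally show ?thesis
      by (simp add: h_def)
  qed
  ultimately show ?thesis
    using K(1) unfolding T_def A_def B_def c_def by blast
qed

end
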